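(* Let $\mathcal{A}=\langle Q,\Sigma\rangle$ be a complete deterministic finite automaton with state set $Q=\{1,2,\dots,n\}$ and input alphabet $\Sigma=\{\sigma_1,\dots,\sigma_k\}$. Let $\mathbb{H}(\mathcal{A})$ be the automaton with state set $R=Q\cup Q'$, where $Q'=\{1',2',\dots,n'\}$ is a copy of $Q$ disjoint from $Q$, and with input alphabet $\Theta=\{a_1,\dots,a_k,b\}$, whose transitions are \[ i.a_j:=i,\qquad i'.a_j:=i.\sigma_j\qquad\text{for all } i=1,\dots,n,\ j=1,\dots,k, \] \[ i.b=i'.b:=i'\qquad\text{for all } i=1,\dots,n, \] where $i.\sigma_j$ is computed in $\mathcal{A}$. Then $\mathbb{H}(\mathcal{A})$ is synchronizing if and only if $\mathcal{A}$ is synchronizing, and if this is the case, then \[ \mathrm{rt}(\mathbb{H}(\mathcal{A}))=2\,\mathrm{rt}(\mathcal{A}). \]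
   Context: A complete deterministic finite automaton (DFA) $\langle Q,\Sigma\rangle$ consists of a finite state set $Q$, a finite input alphabet $\Sigma$, and a totally defined transition function $Q\times\Sigma\to Q$, written $(q,a)\mapsto q.a$. It extends to words $w\in\Sigma^*$ (finite words, including the empty word) by $q.w:=q$ if $w$ is empty and $q.(va):=(q.v).a$ for $v\in\Sigma^*$, $a\in\Sigma$. A word $w\in\Sigma^*$ is a reset word for the DFA if $q.w=q'.w$ for all $q,q'\in Q$. The DFA is synchronizing if it has a reset word; its reset threshold $\mathrm{rt}(\mathcal{A})$ is then the minimum length of its reset words.
   Formalization: The equation rt(H(A)) = 2 rt(A) is claimed only for n ≠ 1, since for n = 1 it always fails: rt(A) = 0 (empty word), while H(A) has two states and rt(H(A)) = 1 (the word b); the equivalence of synchronizability is kept for all n. *)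

theory Defs
  imports Main
begin

record ('q, 'a) automaton =
  states :: "'q set"
  alphabet :: "'a set"
  trans :: "'q \<Rightarrow> 'a \<Rightarrow> 'q"

definition complete_dfa :: "('q, 'a) automaton \<Rightarrow> bool" where
  "complete_dfa A \<longleftrightarrow>
     finite (states A) \<and> finite (alphabet A) \<and>
     (\<forall>q\<in>states A. \<forall>a\<in>alphabet A. trans A q a \<in> states A)"

definition run :: "('q, 'a) automaton \<Rightarrow> 'q \<Rightarrow> 'a list \<Rightarrow> 'q" where
  "run A = foldl (trans A)"

definition reset_word :: "('q, 'a) automaton \<Rightarrow> 'a list \<Rightarrow> bool" where
  "reset_word A w \<longleftrightarrow>
     w \<in> lists (alphabet A) \<and> (\<forall>q\<in>states A. \<forall>q'\<in>states A. run A q w = run A q' w)"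

definition synchronizing :: "('q, 'a) automaton \<Rightarrow> bool" where
  "synchronizing A \<longleftrightarrow> (\<exists>w. reset_word A w)"

(* Only meaningful for synchronizing automata; otherwise the value is unspecified. *)
definition reset_threshold :: "('q, 'a) automaton \<Rightarrow> nat" where
  "reset_threshold A = (LEAST m. \<exists>w. reset_word A w \<and> length w = m)"

(* The state i of Q is Inl i and its copy i' is Inr i; the letter a_j belonging to
   sigma_j is Some sigma_j, and the additional letter b is None. *)
fun H_trans :: "('q \<Rightarrow> 'a \<Rightarrow> 'q) \<Rightarrow> 'q + 'q \<Rightarrow> 'a option \<Rightarrow> 'q + 'q" where
  "H_trans d (Inl i) (Some s) = Inl i"
| "H_trans d (Inr i) (Some s) = Inl (d i s)"
| "H_trans d (Inl i) None = Inr i"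
| "H_trans d (Inr i) None = Inr i"

definition H_automaton :: "('q, 'a) automaton \<Rightarrow> ('q + 'q, 'a option) automaton" where
  "H_automaton A =
     \<lparr> states = states A <+> states A,
       alphabet = insert None (Some ` alphabet A),
       trans = H_trans (trans A) \<rparr>"

lemma complete_dfa_H_automaton:
  "complete_dfa A \<Longrightarrow> complete_dfa (H_automaton A)"
  by (auto simp: complete_dfa_def H_automaton_def)

end

theory Submission
  imports Defs
begin

text \<open>
  Up to the copy it lives in, a state of the constructed automaton moves only when a letter
  \<open>a\<^sub>j\<close> is read directly after a \<open>b\<close>, and then it moves by \<open>\<sigma>\<^sub>j\<close>. Erasing everything else from a reset
  word therefore leaves a reset word of the original automaton of at most half the length.
  Conversely, \<open>b a\<^sub>j\<close> acts as \<open>\<sigma>\<^sub>j\<close> on both copies and ends in the unprimed one, so inserting a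
  \<open>b\<close> before each letter of a nonempty reset word doubles its length and preserves resetting.
\<close>

fun H_encode :: "'a list \<Rightarrow> 'a option list" where
  "H_encode [] = []"
| "H_encode (s # w) = None # Some s # H_encode w"

text \<open>The flag records that the current state is primed.\<close>

fun H_decode :: "bool \<Rightarrow> 'a option list \<Rightarrow> 'a list" where
  "H_decode p [] = []"
| "H_decode p (None # w) = H_decode True w"
| "H_decode True (Some s # w) = s # H_decode False w"
| "H_decode False (Some s # w) = H_decode False w"

lemma length_H_encode: "length (H_encode w) = 2 * length w"
  by (induction w) auto

lemma foldl_H_encode_Inl: "foldl (H_trans d) (Inl q) (H_encode w) = Inl (foldl d q w)"
  by (induction w arbitrary: q) auto

text \<open>The leading \<open>None\<close> sends both copies of \<open>q\<close> to
  \<open>Inr q\<close>, so the run continues as from \<open>Inl q\<close>. The empty word would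
  leave the state primed.\<close>

lemma foldl_H_encode_Inr:
  "w \<noteq> [] \<Longrightarrow> foldl (H_trans d) (Inr q) (H_encode w) = Inl (foldl d q w)"
  by (cases w) (auto simp: foldl_H_encode_Inl)

text \<open>An initial primed state saves the first \<open>b\<close>, hence the additional 1.\<close>

lemma length_H_decode: "2 * length (H_decode p w) \<le> length w + of_bool p"
  by (induction p w rule: H_decode.induct) auto

lemma H_decode_in_lists:
  "w \<in> lists (alphabet (H_automaton A)) \<Longrightarrow> H_decode p w \<in> lists (alphabet A)"
  by (induction p w rule: H_decode.induct) (auto simp: H_automaton_def)

text \<open>\<open>case_sum id id\<close> forgets the copy. Both values of the flag are needed for
  the induction, since letters switch copies.\<close>

lemma foldl_H_decode:
  "case_sum id id (foldl (H_trans d) (if p then Inr q else Inl q) w) = foldl d q (H_decode p w)"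
proof (induction p w arbitrary: q rule: H_decode.induct)
  \<comment> \<open>\<open>None\<close> leads to \<open>Inr q\<close> from either copy, but
    \<open>H_trans\<close> evaluates only once the copy is known.\<close>
  case (2 p w)
  then show ?case by (cases p) auto
qed auto

lemma reset_wordD:
  "reset_word A w \<Longrightarrow> q \<in> states A \<Longrightarrow> q' \<in> states A \<Longrightarrow> run A q w = run A q' w"
  unfolding reset_word_def by blast

lemma states_H_automaton_cases:
  assumes "x \<in> states (H_automaton A)"
  obtains q where "q \<in> states A" and "x = Inl q \<or> x = Inr q"
  using assms by (auto simp: H_automaton_def)

text \<open>It suffices to compare runs from unprimed states, one for each state of
  \<open>A\<close>.\<close>

lemma reset_word_H_decode:
  assumes "reset_word (H_automaton A) w"
  shows "reset_word A (H_decode False w)"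
  unfolding reset_word_def
proof (intro conjI ballI)
  show "H_decode False w \<in> lists (alphabet A)"
    using assms by (intro H_decode_in_lists) (simp add: reset_word_def)
  fix q q' assume "q \<in> states A" "q' \<in> states A"
  then have "run (H_automaton A) (Inl q) w = run (H_automaton A) (Inl q') w"
    by (intro reset_wordD[OF assms]) (auto simp: H_automaton_def)
  moreover have "run A r (H_decode False w) = case_sum id id (run (H_automaton A) (Inl r) w)" for r
    using foldl_H_decode[of "trans A" False r w] by (simp add: run_def H_automaton_def)
  ultimately show "run A q (H_decode False w) = run A q' (H_decode False w)"
    by (simp only:)
qed

lemma H_encode_in_lists:
  "w \<in> lists (alphabet A) \<Longrightarrow> H_encode w \<in> lists (alphabet (H_automaton A))"
  by (induction w) (auto simp: H_automaton_def)

lemma reset_word_H_encode: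
  assumes "reset_word A w" and "w \<noteq> []"
  shows "reset_word (H_automaton A) (H_encode w)"
  unfolding reset_word_def
proof (intro conjI ballI)
  show "H_encode w \<in> lists (alphabet (H_automaton A))"
    using assms(1) by (intro H_encode_in_lists) (simp add: reset_word_def)
  have run: "run (H_automaton A) y (H_encode w) = Inl (run A r w)" if "y = Inl r \<or> y = Inr r" for y r
    using that foldl_H_encode_Inl foldl_H_encode_Inr[OF assms(2)]
    by (auto simp: run_def H_automaton_def)
  fix x x' assume "x \<in> states (H_automaton A)" "x' \<in> states (H_automaton A)"
  then obtain q q' where "q \<in> states A" "x = Inl q \<or> x = Inr q"
    and "q' \<in> states A" "x' = Inl q' \<or> x' = Inr q'"
    by (elim states_H_automaton_cases)
  then show "run (H_automaton A) x (H_encode w) = run (H_automaton A) x' (H_encode w)"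
    using run reset_wordD[OF assms(1)] by metis
qed

text \<open>Covers the empty reset word, whose encoding is again empty and cannot merge the two
  copies of a state.\<close>

lemma reset_word_H_None:
  assumes "reset_word A []"
  shows "reset_word (H_automaton A) [None]"
  unfolding reset_word_def
proof (intro conjI ballI)
  show "[None] \<in> lists (alphabet (H_automaton A))"
    by (simp add: H_automaton_def)
  have run: "run (H_automaton A) y [None] = Inr r" if "y = Inl r \<or> y = Inr r" for y r
    using that by (auto simp: run_def H_automaton_def)
  fix x x' assume "x \<in> states (H_automaton A)" "x' \<in> states (H_automaton A)"
  then obtain q q' where q: "q \<in> states A" "x = Inl q \<or> x = Inr q"
    and q': "q' \<in> states A" "x' = Inl q' \<or> x' = Inr q'"
    by (elim states_H_automaton_cases)
  moreover have "q = q'"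
    using reset_wordD[OF assms q(1) q'(1)] by (simp add: run_def)
  ultimately show "run (H_automaton A) x [None] = run (H_automaton A) x' [None]"
    using run by metis
qed

text \<open>The empty word resets only if there is at most one state. With exactly one, the
  thresholds are 0 for \<open>A\<close> and 1 for \<open>H_automaton A\<close>, so doubling
  fails.\<close>

lemma reset_word_Nil_states:
  assumes "reset_word A []" and "card (states A) \<noteq> 1"
  shows "states A = {}"
proof (rule ccontr)
  assume "states A \<noteq> {}"
  then obtain q where "q \<in> states A" by blast
  with assms(1) have "states A = {q}" by (auto simp: reset_word_def run_def)
  with assms(2) show False by simp
qed

lemma reset_threshold_le: "reset_word A w \<Longrightarrow> reset_threshold A \<le> length w"
  unfolding reset_threshold_def by (rule Least_le) blast

lemma reset_threshold_attained:
  assumes "synchronizing A"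
  obtains w where "reset_word A w" and "length w = reset_threshold A"
proof -
  have "\<exists>w. reset_word A w \<and> length w = reset_threshold A"
    unfolding reset_threshold_def
    by (rule LeastI_ex) (use assms in \<open>auto simp: synchronizing_def\<close>)
  with that show thesis by blast
qed

lemma synchronizing_H_automaton: "synchronizing (H_automaton A) \<longleftrightarrow> synchronizing A"
  unfolding synchronizing_def
  using reset_word_H_decode reset_word_H_encode reset_word_H_None by metis

lemma reset_threshold_H_automaton:
  assumes "synchronizing A" and "card (states A) \<noteq> 1"
  shows "reset_threshold (H_automaton A) = 2 * reset_threshold A"
proof (rule antisym)
  obtain w where w: "reset_word A w" "length w = reset_threshold A"
    using assms(1) by (rule reset_threshold_attained)
  have "reset_word (H_automaton A) (H_encode w)"
  proof (cases "w = []")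
    case True
    \<comment> \<open>Without states, the empty word resets \<open>H_automaton A\<close>
      vacuously.\<close>
    with w(1) assms(2) have "states A = {}" using reset_word_Nil_states by blast
    with True show ?thesis by (auto simp: reset_word_def H_automaton_def)
  qed (rule reset_word_H_encode[OF w(1)])
  from reset_threshold_le[OF this]
  show "reset_threshold (H_automaton A) \<le> 2 * reset_threshold A"
    by (simp add: length_H_encode w(2))
next
  have "synchronizing (H_automaton A)"
    using assms(1) by (simp add: synchronizing_H_automaton)
  then obtain w where w: "reset_word (H_automaton A) w" "length w = reset_threshold (H_automaton A)"
    by (rule reset_threshold_attained)
  \<comment> \<open>With the flag \<open>False\<close> the additional 1 vanishes, which makes the
    bound exact.\<close>
  from reset_threshold_le[OF reset_word_H_decode[OF w(1)]] length_H_decode[of False w] w(2)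
  show "2 * reset_threshold A \<le> reset_threshold (H_automaton A)"
    by simp
qed

theorem theorem2:
  fixes A :: "('q, 'a) automaton"
  assumes "complete_dfa A"
  shows "(synchronizing (H_automaton A) \<longleftrightarrow> synchronizing A) \<and>
         (synchronizing A \<longrightarrow> card (states A) \<noteq> 1 \<longrightarrow>
            reset_threshold (H_automaton A) = 2 * reset_threshold A)"
  by (simp add: synchronizing_H_automaton reset_threshold_H_automaton)

end
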